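(* Let $F$ be a CNF formula over variables $z_1,\ldots,z_n$ with set of satisfying assignments $R_F\subseteq\{0,1\}^n$, let $0<\varepsilon\le 1$, and let $\mathit{pivot}=2\left\lceil 3e^{1/2}\left(1+\frac{1}{\varepsilon}\right)^2\right\rceil$. Let a run of $\mathsf{ApproxMCCore}(F,\mathit{pivot})$ (as invoked from $\mathsf{ApproxMC}(F,\varepsilon,\delta)$) return $c$. Then $$\Pr\left[c\neq\bot \text{ and } (1+\varepsilon)^{-1}|R_F|\le c\le(1+\varepsilon)|R_F|\right]\ \ge\ (1-e^{-3/2})^2>0.6.$$
   Context: Hash family: for positive integers $n,m$, $H_{xor}(n,m,3)$ is the family of functions $h:\{0,1\}^n\to\{0,1\}^m$ of the form $h(y)[j]=a_{j,0}\oplus\bigoplus_{k=1}^n a_{j,k}\cdot y[k]$ for $1\le j\le m$, with $a_{j,k}\in\{0,1\}$; a random $h$ is chosen by picking all $a_{j,k}$ independently and uniformly at random. $\mathsf{BoundedSAT}(F',v)$, for a formula $F'$ (a CNF formula conjoined with xor constraints) and integer $v\ge0$, returns a set of $\min(v,\#F')$ satisfying assignments of $F'$, where $\#F'$ is the number of satisfying assignments. $\mathsf{ApproxMCCore}(F,\mathit{pivot})$: let $S\leftarrow\mathsf{BoundedSAT}(F,\mathit{pivot}+1)$; if $|S|\le\mathit{pivot}$, return $|S|$. Otherwise set $l\leftarrow\lfloor\log_2\mathit{pivot}\rfloor-1$ and $i\leftarrow l-1$, and repeat: $i\leftarrow i+1$; choose $h$ uniformly at random from $H_{xor}(n,i-l,3)$;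 choose $\alpha$ uniformly at random from $\{0,1\}^{i-l}$ (all choices independent of previous ones); $S\leftarrow\mathsf{BoundedSAT}(F\wedge(h(z_1,\ldots,z_n)=\alpha),\mathit{pivot}+1)$; until $1\le|S|\le\mathit{pivot}$ or $i=n$. Then if $|S|>\mathit{pivot}$ or $|S|=0$ return $\bot$, else return $|S|\cdot 2^{i-l}$. $\mathsf{ApproxMC}(F,\varepsilon,\delta)$ with $0<\varepsilon\le1$, $0<\delta\le1$ sets $\mathit{pivot}=2\lceil 3e^{1/2}(1+1/\varepsilon)^2\rceil$ and $t=\lceil 35\log_2(3/\delta)\rceil$, runs $\mathsf{ApproxMCCore}(F,\mathit{pivot})$ $t$ times independently, and returns the median of the non-$\bot$ values returned ($\bot$ if there are none). *)

theory Defs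
  imports "HOL-Probability.Probability" "HOL-Probability.Product_PMF" "HOL-Library.Z2"
begin

text \<open>Elements of \<open>{0,1}^n\<close> are functions \<open>{1..n} \<rightarrow> bit\<close>, extended by \<open>undefined\<close>
  outside \<open>{1..n}\<close>. On the two-element field \<^typ>\<open>bit\<close>, addition is xor.\<close>

definition cube :: "nat \<Rightarrow> (nat \<Rightarrow> bit) set" where
  "cube n = ({1..n} \<rightarrow>\<^sub>E (UNIV :: bit set))"

datatype lit = Pos nat | Neg nat

type_synonym cnf = "lit list list"

primrec lit_var :: "lit \<Rightarrow> nat" where
  "lit_var (Pos k) = k"
| "lit_var (Neg k) = k"

primrec lit_true :: "(nat \<Rightarrow> bit) \<Rightarrow> lit \<Rightarrow> bool" where
  "lit_true y (Pos k) \<longleftrightarrow> y k = 1"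
| "lit_true y (Neg k) \<longleftrightarrow> y k = 0"

definition cnf_over :: "nat \<Rightarrow> cnf \<Rightarrow> bool" where
  "cnf_over n F \<longleftrightarrow> (\<forall>C\<in>set F. \<forall>x\<in>set C. lit_var x \<in> {1..n})"

definition cnf_true :: "(nat \<Rightarrow> bit) \<Rightarrow> cnf \<Rightarrow> bool" where
  "cnf_true y F \<longleftrightarrow> (\<forall>C\<in>set F. \<exists>x\<in>set C. lit_true y x)"

definition sat_assignments :: "nat \<Rightarrow> cnf \<Rightarrow> (nat \<Rightarrow> bit) set" where
  "sat_assignments n F = {y \<in> cube n. cnf_true y F}"

definition xor_row :: "nat \<Rightarrow> (nat \<Rightarrow> bit) \<Rightarrow> (nat \<Rightarrow> bit) \<Rightarrow> bit" where
  "xor_row n r y = r 0 + (\<Sum>k=1..n. r k * y k)"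

text \<open>The member of the family \<open>H_xor(n,m,3)\<close> with coefficients \<open>a (j,k)\<close>.\<close>

definition xor_hash :: "nat \<Rightarrow> nat \<Rightarrow> (nat \<times> nat \<Rightarrow> bit) \<Rightarrow> (nat \<Rightarrow> bit) \<Rightarrow> (nat \<Rightarrow> bit)" where
  "xor_hash n m a y = (\<lambda>j\<in>{1..m}. xor_row n (\<lambda>k. a (j, k)) y)"

text \<open>A random member of \<open>H_xor(n,m,3)\<close>, given by its independent uniform coefficients.\<close>

definition random_coeffs :: "nat \<Rightarrow> nat \<Rightarrow> (nat \<times> nat \<Rightarrow> bit) pmf" where
  "random_coeffs n m = Pi_pmf ({1..m} \<times> {0..n}) 0 (\<lambda>_. pmf_of_set (UNIV :: bit set))"

text \<open>A CNF formula conjoined with xor constraints; the pair \<open>(r, b)\<close> stands for the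
  constraint \<open>r 0 \<oplus> r 1 \<cdot> z\<^sub>1 \<oplus> \<dots> \<oplus> r n \<cdot> z\<^sub>n = b\<close>.\<close>

type_synonym xor_constraint = "(nat \<Rightarrow> bit) \<times> bit"

type_synonym cnf_xor = "cnf \<times> xor_constraint list"

definition models :: "nat \<Rightarrow> cnf_xor \<Rightarrow> (nat \<Rightarrow> bit) set" where
  "models n G = {y \<in> cube n. cnf_true y (fst G) \<and> (\<forall>(r, b)\<in>set (snd G). xor_row n r y = b)}"

definition conj_hash_eq ::
    "cnf \<Rightarrow> nat \<Rightarrow> (nat \<times> nat \<Rightarrow> bit) \<Rightarrow> (nat \<Rightarrow> bit) \<Rightarrow> cnf_xor" where
  "conj_hash_eq F m a \<alpha> = (F, map (\<lambda>j. (\<lambda>k. a (j, k), \<alpha> j)) [1..<Suc m])"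

lemma models_Nil: "models n (F, []) = sat_assignments n F"
  by (simp add: models_def sat_assignments_def)

lemma models_conj_hash_eq:
  assumes "\<alpha> \<in> cube m"
  shows "models n (conj_hash_eq F m a \<alpha>) = {y \<in> sat_assignments n F. xor_hash n m a y = \<alpha>}"
proof -
  have "xor_hash n m a y = \<alpha> \<longleftrightarrow> (\<forall>j\<in>{1..m}. xor_row n (\<lambda>k. a (j, k)) y = \<alpha> j)" for y
    using assms unfolding xor_hash_def cube_def
    by (auto simp: fun_eq_iff restrict_def PiE_def extensional_def)
  moreover have "set [1..<Suc m] = {1..m}"
    by auto
  ultimately show ?thesis
    unfolding models_def conj_hash_eq_def sat_assignments_def
    by (auto simp del: upt_Suc)
qed

text \<open>Which satisfying assignments a bounded solver returns is left open.\<close>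

definition is_BoundedSAT ::
    "nat \<Rightarrow> (cnf_xor \<Rightarrow> nat \<Rightarrow> (nat \<Rightarrow> bit) set) \<Rightarrow> bool" where
  "is_BoundedSAT n B \<longleftrightarrow>
     (\<forall>G v. cnf_over n (fst G) \<longrightarrow>
        B G v \<subseteq> models n G \<and> card (B G v) = min v (card (models n G)))"

text \<open>The value \<^const>\<open>None\<close> is \<open>\<bottom>\<close>. The exit test \<open>n \<le> i\<close> coincides, for \<open>pivot \<ge> 2\<close>, with \<open>i = n\<close> in every
  run of \<open>ApproxMCCore\<close>: the loop is entered only if \<open>F\<close> has more than \<open>pivot\<close> satisfying
  assignments, so it starts from \<open>l < log\<^sub>2 pivot < n\<close>. The inequality makes the
  recursion total.\<close>

function ApproxMCCore_loop ::
    "(cnf_xor \<Rightarrow> nat \<Rightarrow> (nat \<Rightarrow> bit) set) \<Rightarrow> nat \<Rightarrow> cnf \<Rightarrow> nat \<Rightarrow> nat \<Rightarrow> nat \<Rightarrow> nat option pmf" where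
  "ApproxMCCore_loop B n F pivot l i =
     do {
       a \<leftarrow> random_coeffs n (i - l);
       \<alpha> \<leftarrow> pmf_of_set (cube (i - l));
       let S = B (conj_hash_eq F (i - l) a \<alpha>) (pivot + 1);
       if (1 \<le> card S \<and> card S \<le> pivot) \<or> n \<le> i
       then return_pmf (if card S > pivot \<or> card S = 0 then None
                        else Some (card S * 2 ^ (i - l)))
       else ApproxMCCore_loop B n F pivot l (i + 1)
     }"
  by pat_completeness auto
termination
  by (relation "Wellfounded.measure (\<lambda>(B, n, F, pivot, l, i). n - i)") auto

definition ApproxMCCore ::
    "(cnf_xor \<Rightarrow> nat \<Rightarrow> (nat \<Rightarrow> bit) set) \<Rightarrow> nat \<Rightarrow> cnf \<Rightarrow> nat \<Rightarrow> nat option pmf" where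
  "ApproxMCCore B n F pivot =
     (let S = B (F, []) (pivot + 1) in
      if card S \<le> pivot then return_pmf (Some (card S))
      else let l = nat (\<lfloor>log 2 (real pivot)\<rfloor> - 1)
           in ApproxMCCore_loop B n F pivot l l)"

declare ApproxMCCore_loop.simps [simp del]

end

theory Submission
  imports Defs
begin

text \<open>
  Write \<open>X\<close> for the size of the cell selected by \<open>m\<close> random xor constraints and \<open>\<mu> = |R| / 2^m\<close>.
  Since \<open>\<alpha>\<close> is uniform, \<open>E X = \<mu>\<close>, and since two distinct points collide with probability at most
  \<open>2^-m\<close>, \<open>E X\<^sup>2 \<le> \<mu> + \<mu>\<^sup>2\<close>. So \<open>X\<close> satisfies the Chebyshev and Cantelli inequalities with variance
  bound \<open>\<mu>\<close>, which already beats the bound \<open>exp (-3/2)\<close> for 3-wise independent variables, because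
  \<open>3 * sqrt e > exp (3/2)\<close>.

  Let \<open>m\<close> be the iteration with \<open>P / 2 \<le> \<mu> < P\<close> for the pivot \<open>P\<close>. In all earlier iterations the
  loop stops with a bad estimate only if \<open>X\<close> is far below its mean. If \<open>\<mu>\<close> is well below \<open>P\<close>,
  iteration \<open>m\<close> stops with a good estimate unless \<open>X\<close> deviates from \<open>\<mu>\<close>. If \<open>\<mu>\<close> is close to \<open>P\<close>,
  iteration \<open>m\<close> may instead see more than \<open>P\<close> solutions, but then iteration \<open>m + 1\<close>, whose mean is
  close to \<open>P / 2\<close>, is likely to succeed. Optimising over \<open>x = \<mu> / P\<close> gives total success
  probability at least \<open>0.61\<close>.
\<close>

section \<open>Preliminaries on \<open>pmf\<close>s, bits and the cube\<close>

lemma prob_bind_pmf: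
  "measure_pmf.prob (M \<bind> f) A = measure_pmf.expectation M (\<lambda>x. measure_pmf.prob (f x) A)"
proof -
  have "ennreal (measure_pmf.prob (M \<bind> f) A) = (\<integral>\<^sup>+x. ennreal (measure_pmf.prob (f x) A) \<partial>M)"
    by (simp flip: measure_pmf.emeasure_eq_measure)
  also have "\<dots> = ennreal (measure_pmf.expectation M (\<lambda>x. measure_pmf.prob (f x) A))"
    by (intro nn_integral_eq_integral measure_pmf.integrable_const_bound[where B = 1]) auto
  finally show ?thesis
    by (subst (asm) ennreal_inj) (auto intro!: integral_nonneg_AE)
qed

lemma UNIV_bit: "(UNIV :: bit set) = {0, 1}"
  using bit.exhaust by auto

lemma finite_UNIV_bit [simp]: "finite (UNIV :: bit set)"
  and card_UNIV_bit: "card (UNIV :: bit set) = 2"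
  by (simp_all add: UNIV_bit)

lemma finite_cube [simp]: "finite (cube n)"
  and card_cube: "card (cube n) = 2 ^ n"
  and cube_nonempty [simp]: "cube n \<noteq> {}"
  unfolding cube_def by (auto intro!: finite_PiE simp: card_PiE card_UNIV_bit PiE_eq_empty_iff)

lemma xor_hash_in_cube: "xor_hash n m a y \<in> cube m"
  by (auto simp: xor_hash_def cube_def)

lemma finite_set_random_coeffs: "finite (set_pmf (random_coeffs n m))"
proof -
  have "set_pmf (random_coeffs n m) \<subseteq> PiE_dflt ({1..m} \<times> {0..n}) 0 (\<lambda>_. UNIV)"
    unfolding random_coeffs_def
    using set_Pi_pmf_subset'[of "{1..m} \<times> {0..n}" 0 "\<lambda>_. pmf_of_set (UNIV :: bit set)"]
    by (auto simp: PiE_dflt_def)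
  then show ?thesis
    by (rule finite_subset) (rule finite_PiE_dflt, auto)
qed

section \<open>Collision probability of two points under a random xor hash\<close>

text \<open>Fix a coordinate \<open>k\<close> where the points differ and condition on all
  coefficients outside column \<open>k\<close>. In each row a collision then forces the remaining
  coefficient, since \<open>y k + y' k = 1\<close>, and \<open>m\<close> independent fair bits hit
  the forced values with probability \<open>1 / 2 ^ m\<close>.\<close>

lemma xor_hash_collision:
  assumes "y \<in> cube n" "y' \<in> cube n" "y \<noteq> y'"
  shows "measure_pmf.prob (random_coeffs n m) {a. xor_hash n m a y = xor_hash n m a y'} \<le> 1 / 2 ^ m"
proof -
  obtain k where k: "k \<in> {1..n}" "y k \<noteq> y' k"
    using assms unfolding cube_def by (metis PiE_ext)
  define K where "K = {1..m} \<times> {k}"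
  define L where "L = {1..m} \<times> ({0..n} - {k})"
  define U where "U = (\<lambda>_ :: nat \<times> nat. pmf_of_set (UNIV :: bit set))"
  have KL: "finite K" "finite L" "K \<inter> L = {}" "{1..m} \<times> {0..n} = L \<union> K"
    using k by (auto simp: K_def L_def)
  let ?mix = "\<lambda>g f x. if x \<in> L then g x else f x"
  let ?C = "\<lambda>g. {f. xor_hash n m (?mix g f) y = xor_hash n m (?mix g f) y'}"
  have row: "f (j, k) = (\<Sum>i\<in>{1..n}-{k}. g (j, i) * (y i + y' i))"
    if "f \<in> ?C g" and j: "j \<in> {1..m}" for f g :: "nat \<times> nat \<Rightarrow> bit" and j
  proof -
    have sp: "xor_row n (\<lambda>i. ?mix g f (j, i)) z
        = g (j, 0) + (f (j, k) * z k + (\<Sum>i\<in>{1..n}-{k}. g (j, i) * z i))" for z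
      unfolding xor_row_def using k j
      by (subst sum.remove[of _ k]) (auto simp: L_def intro!: arg_cong2[where f = "(+)"] sum.cong)
    have "xor_row n (\<lambda>i. ?mix g f (j, i)) y = xor_row n (\<lambda>i. ?mix g f (j, i)) y'"
      using that by (auto simp: xor_hash_def fun_eq_iff restrict_def split: if_splits)
    then have "f (j, k) * y k + (\<Sum>i\<in>{1..n}-{k}. g (j, i) * y i)
        = f (j, k) * y' k + (\<Sum>i\<in>{1..n}-{k}. g (j, i) * y' i)"
      unfolding sp by (simp only: add_left_cancel)
    moreover have "(\<Sum>i\<in>{1..n}-{k}. g (j, i) * (y i + y' i))
        = (\<Sum>i\<in>{1..n}-{k}. g (j, i) * y i) + (\<Sum>i\<in>{1..n}-{k}. g (j, i) * y' i)"
      by (simp only: distrib_left sum.distrib)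
    moreover have "u = s + t" if "u * p + s = u * q + t" "p \<noteq> q" for u p q s t :: bit
      using that by (cases u; cases p; cases q; cases s; cases t) auto
    ultimately show ?thesis
      using k(2) by metis
  qed
  have cond: "measure_pmf.prob (Pi_pmf K 0 U) (?C g) \<le> 1 / 2 ^ m" for g
  proof -
    \<comment> \<open>Off \<open>K\<close> this takes the default \<open>0\<close> of
      \<open>Pi_pmf\<close>, so that it is a single point of the product space.\<close>
    define f0 where
      "f0 = (\<lambda>(j, i). if (j, i) \<in> K then (\<Sum>i\<in>{1..n}-{k}. g (j, i) * (y i + y' i)) else 0)"
    have "f = f0" if "f \<in> ?C g" "f \<in> set_pmf (Pi_pmf K 0 U)" for f
    proof
      fix x :: "nat \<times> nat"
      show "f x = f0 x"
        using row[OF that(1)] that(2) set_Pi_pmf_subset[OF KL(1), of 0 U]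
        by (cases "x \<in> K"; cases x) (auto simp: f0_def K_def)
    qed
    then have "measure_pmf.prob (Pi_pmf K 0 U) (?C g) \<le> measure_pmf.prob (Pi_pmf K 0 U) {f0}"
      by (intro measure_pmf.finite_measure_mono_AE) (auto simp: AE_measure_pmf_iff)
    also have "\<dots> = (\<Prod>x\<in>K. pmf (U x) (f0 x))"
      using KL(1) by (simp add: measure_pmf_single pmf_Pi f0_def case_prod_beta)
    also have "\<dots> = 1 / 2 ^ m"
      by (simp add: U_def K_def card_UNIV_bit card_cartesian_product power_one_over)
    finally show ?thesis .
  qed
  have "random_coeffs n m
      = Pi_pmf L 0 U \<bind> (\<lambda>g. map_pmf (?mix g) (Pi_pmf K 0 U))"
    unfolding random_coeffs_def KL(4) U_def[symmetric] using KL
    by (subst Pi_pmf_union)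
       (auto simp: pair_pmf_def map_bind_pmf map_pmf_def bind_assoc_pmf bind_return_pmf)
  then have "measure_pmf.prob (random_coeffs n m) {a. xor_hash n m a y = xor_hash n m a y'}
      = measure_pmf.expectation (Pi_pmf L 0 U) (\<lambda>g. measure_pmf.prob (Pi_pmf K 0 U) (?C g))"
    by (simp add: prob_bind_pmf vimage_def)
  also have "\<dots> \<le> measure_pmf.expectation (Pi_pmf L 0 U) (\<lambda>g. 1 / 2 ^ m)"
    using cond by (intro integral_mono measure_pmf.integrable_const_bound[where B = 1]) auto
  finally show ?thesis
    by simp
qed

section \<open>First and second moment of the cell size\<close>

text \<open>This is the full cell size, before a bounded solver caps it at the pivot plus
  one.\<close>

definition cell_size_pmf :: "nat \<Rightarrow> (nat \<Rightarrow> bit) set \<Rightarrow> nat \<Rightarrow> nat pmf" where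
  "cell_size_pmf n R m = do {
     a \<leftarrow> random_coeffs n m;
     \<alpha> \<leftarrow> pmf_of_set (cube m);
     return_pmf (card {y \<in> R. xor_hash n m a y = \<alpha>})
   }"

lemma finite_set_cell_size_pmf: "finite (set_pmf (cell_size_pmf n R m))"
  by (simp add: cell_size_pmf_def finite_set_random_coeffs)

lemma expectation_cell_size_pmf:
  "measure_pmf.expectation (cell_size_pmf n R m) f =
     measure_pmf.expectation (random_coeffs n m)
       (\<lambda>a. (\<Sum>\<alpha>\<in>cube m. f (card {y \<in> R. xor_hash n m a y = \<alpha>})) / 2 ^ m)" for f :: "nat \<Rightarrow> real"
  unfolding cell_size_pmf_def
  by (subst pmf_expectation_bind[OF finite_set_random_coeffs _ subset_refl])
     (simp_all add: pmf_expectation_bind_pmf_of_set card_cube divide_inverse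
        sum_distrib_right mult.commute sum_distrib_left
        integral_measure_pmf[OF finite_set_random_coeffs])

lemma sum_of_bool_eq_point:
  "finite S \<Longrightarrow> x \<in> S \<Longrightarrow> (\<Sum>\<alpha>\<in>S. of_bool (x = \<alpha>) * f \<alpha>) = (f x :: real)"
  by (subst sum.remove[of _ x]) auto

text \<open>For every fixed hash the cells partition \<open>R\<close>, so the uniform choice of
  \<alpha> alone already gives the mean.\<close>

lemma cell_size_mean:
  assumes "finite R"
  shows "measure_pmf.expectation (cell_size_pmf n R m) real = card R / 2 ^ m"
proof -
  have "(\<Sum>\<alpha>\<in>cube m. real (card {y \<in> R. xor_hash n m a y = \<alpha>})) = card R" for a
  proof -
    have "(\<Sum>\<alpha>\<in>cube m. real (card {y \<in> R. xor_hash n m a y = \<alpha>}))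
        = (\<Sum>\<alpha>\<in>cube m. \<Sum>y\<in>R. of_bool (xor_hash n m a y = \<alpha>) * 1)"
      using assms by (simp add: Int_def)
    also have "\<dots> = (\<Sum>y\<in>R. \<Sum>\<alpha>\<in>cube m. of_bool (xor_hash n m a y = \<alpha>) * 1)"
      by (rule sum.swap)
    also have "\<dots> = (\<Sum>y\<in>R. 1)"
      by (intro sum.cong refl sum_of_bool_eq_point) (auto simp: xor_hash_in_cube)
    finally show ?thesis by simp
  qed
  then show ?thesis
    by (simp add: expectation_cell_size_pmf)
qed

text \<open>Squared cell sizes summed over all \<alpha> count the ordered colliding pairs. The
  diagonal yields \<mu>; charging every pair a further \<open>1 / 2 ^ m\<close> covers the
  collisions of distinct points and yields \<open>\<mu>\<^sup>2\<close>.\<close>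

lemma cell_size_second_moment:
  fixes m :: nat
  assumes R: "R \<subseteq> cube n"
  defines "\<mu> \<equiv> card R / 2 ^ m"
  shows "measure_pmf.expectation (cell_size_pmf n R m) (\<lambda>X. (real X)\<^sup>2) \<le> \<mu> + \<mu>\<^sup>2"
proof -
  let ?h = "xor_hash n m"
  let ?P = "random_coeffs n m"
  have fin: "finite R"
    using R finite_cube finite_subset by blast
  have sq: "(\<Sum>\<alpha>\<in>cube m. (real (card {y \<in> R. ?h a y = \<alpha>}))\<^sup>2)
      = (\<Sum>y\<in>R. \<Sum>y'\<in>R. of_bool (?h a y = ?h a y'))" for a
  proof -
    have "(\<Sum>\<alpha>\<in>cube m. (real (card {y \<in> R. ?h a y = \<alpha>}))\<^sup>2)
        = (\<Sum>\<alpha>\<in>cube m. \<Sum>y\<in>R. \<Sum>y'\<in>R. of_bool (?h a y = \<alpha>) * of_bool (?h a y' = \<alpha>))"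
      unfolding sum_product[symmetric] power2_eq_square using fin by (simp add: Int_def)
    also have "\<dots> = (\<Sum>y\<in>R. \<Sum>\<alpha>\<in>cube m. \<Sum>y'\<in>R. of_bool (?h a y = \<alpha>) * of_bool (?h a y' = \<alpha>))"
      by (rule sum.swap)
    also have "\<dots> = (\<Sum>y\<in>R. \<Sum>y'\<in>R. \<Sum>\<alpha>\<in>cube m. of_bool (?h a y = \<alpha>) * of_bool (?h a y' = \<alpha>))"
      by (intro sum.cong refl sum.swap)
    also have "\<dots> = (\<Sum>y\<in>R. \<Sum>y'\<in>R. of_bool (?h a y' = ?h a y))"
      by (intro sum.cong refl sum_of_bool_eq_point) (auto simp: xor_hash_in_cube)
    finally show ?thesis by (simp add: eq_commute)
  qed
  have int: "integrable ?P f" for f :: "_ \<Rightarrow> real"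
    by (rule integrable_measure_pmf_finite[OF finite_set_random_coeffs])
  have "measure_pmf.expectation (cell_size_pmf n R m) (\<lambda>X. (real X)\<^sup>2)
      = (\<Sum>y\<in>R. \<Sum>y'\<in>R. measure_pmf.expectation ?P (\<lambda>a. of_bool (?h a y = ?h a y'))) / 2 ^ m"
    by (simp add: expectation_cell_size_pmf sq int)
  also have "\<dots> = (\<Sum>y\<in>R. \<Sum>y'\<in>R. measure_pmf.prob ?P {a. ?h a y = ?h a y'}) / 2 ^ m"
  proof -
    have "measure_pmf.expectation ?P (\<lambda>a. of_bool (?h a y = ?h a y'))
        = measure_pmf.prob ?P {a. ?h a y = ?h a y'}" for y y'
    proof -
      have "(\<lambda>a. of_bool (?h a y = ?h a y')) = (indicator {a. ?h a y = ?h a y'} :: _ \<Rightarrow> real)"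
        by (auto simp: indicator_def)
      then show ?thesis by simp
    qed
    then show ?thesis by simp
  qed
  also have "\<dots> \<le> (\<Sum>y\<in>R. \<Sum>y'\<in>R. of_bool (y = y') + 1 / 2 ^ m) / 2 ^ m"
    using xor_hash_collision[of _ n _ m] R
    by (intro divide_right_mono sum_mono) (auto simp: of_bool_def add_increasing2 subset_iff)
  also have "\<dots> = \<mu> + \<mu>\<^sup>2"
  proof -
    have "(\<Sum>y\<in>R. \<Sum>y'\<in>R. of_bool (y = y') + 1 / 2 ^ m) = real (card R) * (1 + real (card R) / 2 ^ m)"
      using fin by (simp add: sum.distrib of_bool_def)
    then show ?thesis
      by (simp add: \<mu>_def power2_eq_square field_simps)
  qed
  finally show ?thesis .
qed

section \<open>Chebyshev and Cantelli tails of the cell size\<close>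

text \<open>Markov's inequality for the square of the centred size shifted by \<open>s\<close>. The
  free shift serves two purposes: \<open>s = 0\<close> gives Chebyshev, and \<open>s\<close> equal
  to plus or minus \<open>\<mu> / t\<close> gives the two one-sided Cantelli bounds.\<close>

lemma cell_size_shifted_tail:
  fixes m :: nat
  assumes R: "R \<subseteq> cube n" and "0 < r"
  defines "\<mu> \<equiv> card R / 2 ^ m"
  shows "measure_pmf.prob (cell_size_pmf n R m) {X. r \<le> \<bar>real X - \<mu> + s\<bar>} \<le> (\<mu> + s\<^sup>2) / r\<^sup>2"
proof -
  let ?D = "cell_size_pmf n R m"
  have int: "integrable ?D f" for f :: "nat \<Rightarrow> real"
    by (rule integrable_measure_pmf_finite[OF finite_set_cell_size_pmf])
  have fin: "finite R"
    using R finite_cube finite_subset by blast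
  have "measure_pmf.prob ?D {X. r \<le> \<bar>real X - \<mu> + s\<bar>}
      = measure_pmf.expectation ?D (indicator {X. r \<le> \<bar>real X - \<mu> + s\<bar>})"
    by simp
  also have "\<dots> \<le> measure_pmf.expectation ?D (\<lambda>X. (real X - \<mu> + s)\<^sup>2 / r\<^sup>2)"
  proof (intro integral_mono int)
    fix X
    have "r\<^sup>2 \<le> (real X - \<mu> + s)\<^sup>2" if "r \<le> \<bar>real X - \<mu> + s\<bar>"
      using that \<open>0 < r\<close> by (intro abs_le_square_iff[THEN iffD1]) simp
    then show "indicator {X. r \<le> \<bar>real X - \<mu> + s\<bar>} X \<le> (real X - \<mu> + s)\<^sup>2 / r\<^sup>2"
      using \<open>0 < r\<close> by (auto simp: indicator_def divide_simps)
  qed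
  also have "\<dots> = measure_pmf.expectation ?D
      (\<lambda>X. (real X)\<^sup>2 + 2 * (s - \<mu>) * real X + (s - \<mu>)\<^sup>2) / r\<^sup>2"
    by (simp add: power2_eq_square algebra_simps)
  also have "measure_pmf.expectation ?D (\<lambda>X. (real X)\<^sup>2 + 2 * (s - \<mu>) * real X + (s - \<mu>)\<^sup>2)
      = measure_pmf.expectation ?D (\<lambda>X. (real X)\<^sup>2) + 2 * (s - \<mu>) * \<mu> + (s - \<mu>)\<^sup>2"
    by (simp add: int cell_size_mean[OF fin] \<mu>_def)
  also have "\<dots> / r\<^sup>2 \<le> (\<mu> + \<mu>\<^sup>2 + 2 * (s - \<mu>) * \<mu> + (s - \<mu>)\<^sup>2) / r\<^sup>2"
    using cell_size_second_moment[OF R, where m = m] by (intro divide_right_mono) (auto simp: \<mu>_def)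
  also have "\<dots> = (\<mu> + s\<^sup>2) / r\<^sup>2"
    by (simp add: power2_eq_square algebra_simps)
  finally show ?thesis .
qed

lemma cell_size_chebyshev:
  fixes m :: nat
  assumes R: "R \<subseteq> cube n" and "0 < t"
  defines "\<mu> \<equiv> card R / 2 ^ m"
  shows "measure_pmf.prob (cell_size_pmf n R m) {X. t \<le> \<bar>real X - \<mu>\<bar>} \<le> \<mu> / t\<^sup>2"
  using cell_size_shifted_tail[OF R \<open>0 < t\<close>, where m = m and s = 0] by (simp add: \<mu>_def)

text \<open>The shift \<open>\<mu> / t\<close> is the one that minimises
  \<open>(\<mu> + s\<^sup>2) / (t + s)\<^sup>2\<close> over nonnegative \<open>s\<close>.\<close>

lemma cantelli_shift:
  assumes "0 < t" "0 \<le> (\<mu> :: real)"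
  shows "(\<mu> + (\<mu> / t)\<^sup>2) / (t + \<mu> / t)\<^sup>2 = \<mu> / (\<mu> + t\<^sup>2)"
proof -
  have p: "0 < \<mu> + t\<^sup>2"
    using assms by (simp add: add_nonneg_pos)
  have "\<mu> + (\<mu> / t)\<^sup>2 = \<mu> * (\<mu> + t\<^sup>2) / t\<^sup>2" "(t + \<mu> / t)\<^sup>2 = (\<mu> + t\<^sup>2)\<^sup>2 / t\<^sup>2"
    using assms by (simp_all add: field_simps power2_eq_square)
  then show ?thesis
    using p assms by (simp add: power2_eq_square)
qed

lemma cell_size_cantelli_upper:
  fixes m :: nat
  assumes R: "R \<subseteq> cube n" and "0 < t"
  defines "\<mu> \<equiv> card R / 2 ^ m"
  shows "measure_pmf.prob (cell_size_pmf n R m) {X. \<mu> + t \<le> real X} \<le> \<mu> / (\<mu> + t\<^sup>2)"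
proof -
  have \<mu>: "0 \<le> \<mu>"
    by (simp add: \<mu>_def)
  have "measure_pmf.prob (cell_size_pmf n R m) {X. \<mu> + t \<le> real X}
      \<le> measure_pmf.prob (cell_size_pmf n R m) {X. t + \<mu> / t \<le> \<bar>real X - \<mu> + \<mu> / t\<bar>}"
    using \<mu> \<open>0 < t\<close> by (intro measure_pmf.finite_measure_mono) auto
  also have "\<dots> \<le> (\<mu> + (\<mu> / t)\<^sup>2) / (t + \<mu> / t)\<^sup>2"
    unfolding \<mu>_def using \<mu> \<open>0 < t\<close>
    by (intro cell_size_shifted_tail[OF R]) (auto simp: add_pos_nonneg)
  finally show ?thesis
    using cantelli_shift[OF \<open>0 < t\<close> \<mu>] by simp
qed

lemma cell_size_cantelli_lower:
  fixes m :: nat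
  assumes R: "R \<subseteq> cube n" and "0 < t"
  defines "\<mu> \<equiv> card R / 2 ^ m"
  shows "measure_pmf.prob (cell_size_pmf n R m) {X. real X \<le> \<mu> - t} \<le> \<mu> / (\<mu> + t\<^sup>2)"
proof -
  have \<mu>: "0 \<le> \<mu>"
    by (simp add: \<mu>_def)
  then have "0 \<le> \<mu> / t"
    using \<open>0 < t\<close> by simp
  then have "measure_pmf.prob (cell_size_pmf n R m) {X. real X \<le> \<mu> - t}
      \<le> measure_pmf.prob (cell_size_pmf n R m) {X. t + \<mu> / t \<le> \<bar>real X - \<mu> + - (\<mu> / t)\<bar>}"
    by (intro measure_pmf.finite_measure_mono) auto
  also have "\<dots> \<le> (\<mu> + (- (\<mu> / t))\<^sup>2) / (t + \<mu> / t)\<^sup>2"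
    unfolding \<mu>_def using \<mu> \<open>0 < t\<close>
    by (intro cell_size_shifted_tail[OF R]) (auto simp: add_pos_nonneg)
  finally show ?thesis
    using cantelli_shift[OF \<open>0 < t\<close> \<mu>] by simp
qed

section \<open>The loop as a walk through random cell sizes\<close>

text \<open>The solver's cap at \<open>P + 1\<close> is invisible: the loop only distinguishes sizes
  \<open>0\<close>, \<open>1\<close> to \<open>P\<close>, and above \<open>P\<close>, and uses the
  exact value in the middle range alone.\<close>

lemma ApproxMCCore_loop_eq_bind_cell_size:
  assumes "cnf_over n F" "is_BoundedSAT n B"
  shows "ApproxMCCore_loop B n F P l i =
    cell_size_pmf n (sat_assignments n F) (i - l) \<bind> (\<lambda>X.
      if (1 \<le> X \<and> X \<le> P) \<or> n \<le> i
      then return_pmf (if X > P \<or> X = 0 then None else Some (X * 2 ^ (i - l)))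
      else ApproxMCCore_loop B n F P l (i + 1))"
proof -
  have card_B: "card (B (conj_hash_eq F m a \<alpha>) (Suc P))
      = min (Suc P) (card {y \<in> sat_assignments n F. xor_hash n m a y = \<alpha>})"
    if "\<alpha> \<in> cube m" for m a \<alpha>
    using assms(2)[unfolded is_BoundedSAT_def, rule_format, of "conj_hash_eq F m a \<alpha>" "Suc P"]
      assms(1) models_conj_hash_eq[OF that, of n F a] by (simp add: conj_hash_eq_def)
  show ?thesis
    unfolding cell_size_pmf_def bind_assoc_pmf bind_return_pmf
    by (subst ApproxMCCore_loop.simps)
       (intro bind_pmf_cong refl, auto simp: Let_def card_B min_def)
qed

text \<open>This collects what is used of the pivot formula: \<open>9.8\<close> lies below
  \<open>6 * exp (1/2)\<close>, and \<open>40\<close> results from \<open>\<epsilon> \<le> 1\<close>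
  and the rounding up. The last assumption says that the loop is entered.\<close>

locale approx_mc_core_run =
  fixes B :: "cnf_xor \<Rightarrow> nat \<Rightarrow> (nat \<Rightarrow> bit) set"
    and n P l :: nat and F :: cnf and \<epsilon> :: real
  assumes cnf: "cnf_over n F" and sat: "is_BoundedSAT n B"
    and \<epsilon>: "0 < \<epsilon>" "\<epsilon> \<le> 1"
    and P_ge: "40 \<le> P" and P_ge_\<epsilon>: "9.8 * (1 + 1 / \<epsilon>)\<^sup>2 \<le> P"
    and l: "2 ^ Suc l \<le> P"
    and P_less: "P < card (sat_assignments n F)"
begin

abbreviation "R \<equiv> sat_assignments n F"
abbreviation "D \<equiv> cell_size_pmf n R"

definition "\<mu> m = real (card R) / 2 ^ m"
text \<open>With this relative error \<open>1 - \<beta>\<close> is exactly the lower accuracy limit,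
  and \<beta> is at most \<epsilon>, so a symmetric window around the mean meets both
  limits.\<close>

definition "\<beta> = \<epsilon> / (1 + \<epsilon>)"
definition "G = {r. \<exists>c. r = Some c \<and> inverse (1 + \<epsilon>) * real (card R) \<le> real c \<and>
  real c \<le> (1 + \<epsilon>) * real (card R)}"
definition "success i = measure_pmf.prob (ApproxMCCore_loop B n F P l i) G"
definition "accepting m = {X. 1 \<le> X \<and> X \<le> P \<and> Some (X * 2 ^ m) \<in> G}"

lemma R_subset: "R \<subseteq> cube n"
  by (auto simp: sat_assignments_def)

lemma \<beta>: "0 < \<beta>" "\<beta> \<le> 1 / 2" "\<beta> \<le> \<epsilon>" "1 - \<beta> = inverse (1 + \<epsilon>)" "9.8 \<le> \<beta>\<^sup>2 * P"
proof -
  have "\<beta> * (1 + 1 / \<epsilon>) = 1"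
    using \<epsilon> by (simp add: \<beta>_def divide_simps)
  then have "\<beta>\<^sup>2 * (1 + 1 / \<epsilon>)\<^sup>2 = 1"
    by (metis power_mult_distrib power_one)
  then show "9.8 \<le> \<beta>\<^sup>2 * P"
    using mult_left_mono[OF P_ge_\<epsilon>, of "\<beta>\<^sup>2"] by (simp add: algebra_simps)
qed (use \<epsilon> in \<open>auto simp: \<beta>_def field_simps\<close>)

lemma \<mu>_pos: "0 < \<mu> m"
  using P_less by (auto simp: \<mu>_def)

lemma \<mu>_Suc: "\<mu> (Suc m) = \<mu> m / 2"
  by (simp add: \<mu>_def)

lemma acceptingI:
  assumes "(1 - \<beta>) * \<mu> m < real X" "real X \<le> (1 + \<epsilon>) * \<mu> m" "X \<le> P"
  shows "X \<in> accepting m"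
proof -
  have "(1 - \<beta>) * \<mu> m > 0"
    using \<beta> \<mu>_pos by simp
  then have "0 < real X"
    using assms by linarith
  moreover have "inverse (1 + \<epsilon>) * real (card R) \<le> real X * 2 ^ m"
    using assms(1) \<epsilon> unfolding \<beta>(4) \<mu>_def by (simp add: divide_simps mult_ac)
  moreover have "real X * 2 ^ m \<le> (1 + \<epsilon>) * real (card R)"
    using assms(2) unfolding \<mu>_def by (simp add: field_simps)
  ultimately show ?thesis
    using assms(3) by (auto simp: accepting_def G_def)
qed

lemma success_eq:
  "success i = measure_pmf.expectation (D (i - l)) (\<lambda>X. measure_pmf.prob
      (if (1 \<le> X \<and> X \<le> P) \<or> n \<le> i
       then return_pmf (if X > P \<or> X = 0 then None else Some (X * 2 ^ (i - l)))
       else ApproxMCCore_loop B n F P l (i + 1)) G)"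
  unfolding success_def by (subst ApproxMCCore_loop_eq_bind_cell_size[OF cnf sat]) (rule prob_bind_pmf)

lemma success_ge_accepting: "measure_pmf.prob (D m) (accepting m) \<le> success (l + m)"
proof -
  have "measure_pmf.prob (D m) (accepting m) = measure_pmf.expectation (D m) (indicator (accepting m))"
    by simp
  also have "\<dots> \<le> success (l + m)"
    unfolding success_eq
    by (simp only: add_diff_cancel_left',
        intro integral_mono integrable_measure_pmf_finite finite_set_cell_size_pmf)
       (auto simp: accepting_def indicator_def)
  finally show ?thesis .
qed

text \<open>Cells larger than \<open>P\<close> lead to the next iteration. So do empty cells, but
  their contribution is dropped.\<close>

lemma success_step:
  assumes "l + m < n" "v \<le> success (l + Suc m)"
  shows "measure_pmf.prob (D m) (accepting m) + v * measure_pmf.prob (D m) {X. P < X}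
    \<le> success (l + m)"
proof -
  have int: "integrable (D m) f" for f :: "nat \<Rightarrow> real"
    by (rule integrable_measure_pmf_finite[OF finite_set_cell_size_pmf])
  have "measure_pmf.prob (D m) (accepting m) + v * measure_pmf.prob (D m) {X. P < X}
      = measure_pmf.expectation (D m) (\<lambda>X. indicator (accepting m) X + v * indicator {X. P < X} X)"
    by (simp add: int)
  also have "\<dots> \<le> success (l + m)"
    unfolding success_eq[of "l + m"]
    using assms
    by (simp only: add_diff_cancel_left', intro integral_mono int)
       (auto simp: accepting_def indicator_def success_def)
  finally show ?thesis .
qed

text \<open>A size outside \<open>bad\<close> is either accepted, which is worth \<open>1\<close>,
  or exceeds \<open>P\<close> and continues, which is worth at least \<open>v\<close>.\<close>

lemma success_step_avoiding:
  assumes "l + m < n" "v \<le> success (l + Suc m)" "0 \<le> v" "v \<le> 1"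
    and bad: "\<And>X. X \<notin> bad \<Longrightarrow> X \<le> P \<Longrightarrow> X \<in> accepting m"
  shows "v * (1 - measure_pmf.prob (D m) bad) \<le> success (l + m)"
proof -
  have "UNIV \<subseteq> accepting m \<union> {X. P < X} \<union> bad"
    using bad by fastforce
  then have "measure_pmf.prob (D m) UNIV \<le> measure_pmf.prob (D m) (accepting m \<union> {X. P < X} \<union> bad)"
    by (intro measure_pmf.finite_measure_mono) auto
  also have "\<dots> \<le> measure_pmf.prob (D m) (accepting m) + measure_pmf.prob (D m) {X. P < X}
      + measure_pmf.prob (D m) bad"
    by (intro order_trans[OF measure_Un_le] add_right_mono measure_Un_le) auto
  finally have "1 - measure_pmf.prob (D m) bad
      \<le> measure_pmf.prob (D m) (accepting m) + measure_pmf.prob (D m) {X. P < X}"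
    by simp
  then have "v * (1 - measure_pmf.prob (D m) bad)
      \<le> v * measure_pmf.prob (D m) (accepting m) + v * measure_pmf.prob (D m) {X. P < X}"
    using \<open>0 \<le> v\<close> by (simp add: mult_left_mono flip: distrib_left)
  also have "\<dots> \<le> measure_pmf.prob (D m) (accepting m) + v * measure_pmf.prob (D m) {X. P < X}"
    using assms(3,4) by (simp add: mult_left_le_one_le)
  finally show ?thesis
    using success_step[OF assms(1,2)] by linarith
qed

section \<open>Single iterations and their accumulation back to the start\<close>

lemma prob_lower_tail:
  assumes "y \<le> \<beta>\<^sup>2 * \<mu> m" "0 \<le> y"
  shows "measure_pmf.prob (D m) {X. real X \<le> (1 - \<beta>) * \<mu> m} \<le> 1 / (1 + y)"
proof -
  have "measure_pmf.prob (D m) {X. real X \<le> (1 - \<beta>) * \<mu> m} \<le> \<mu> m / (\<mu> m + (\<beta> * \<mu> m)\<^sup>2)"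
    using cell_size_cantelli_lower[OF R_subset, of "\<beta> * \<mu> m" m] \<beta>(1) \<mu>_pos[of m]
    by (simp add: \<mu>_def[symmetric] algebra_simps)
  also have "\<mu> m + (\<beta> * \<mu> m)\<^sup>2 = \<mu> m * (1 + \<beta>\<^sup>2 * \<mu> m)"
    by (simp add: power2_eq_square algebra_simps)
  also have "\<mu> m / (\<mu> m * (1 + \<beta>\<^sup>2 * \<mu> m)) = 1 / (1 + \<beta>\<^sup>2 * \<mu> m)"
    using \<mu>_pos[of m] by simp
  also have "\<dots> \<le> 1 / (1 + y)"
    using assms by (intro divide_left_mono) auto
  finally show ?thesis .
qed

lemma prob_deviation:
  assumes "y \<le> \<beta>\<^sup>2 * \<mu> m" "0 < y"
  shows "measure_pmf.prob (D m) {X. \<beta> * \<mu> m \<le> \<bar>real X - \<mu> m\<bar>} \<le> 1 / y"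
proof -
  have "measure_pmf.prob (D m) {X. \<beta> * \<mu> m \<le> \<bar>real X - \<mu> m\<bar>} \<le> \<mu> m / (\<beta> * \<mu> m)\<^sup>2"
    using cell_size_chebyshev[OF R_subset, of "\<beta> * \<mu> m" m] \<beta>(1) \<mu>_pos[of m]
    by (simp add: \<mu>_def[symmetric])
  also have "\<dots> = 1 / (\<beta>\<^sup>2 * \<mu> m)"
    using \<mu>_pos[of m] by (simp add: power2_eq_square field_simps)
  also have "\<dots> \<le> 1 / y"
    using assms by (intro divide_left_mono) (auto intro: mult_pos_pos less_le_trans)
  finally show ?thesis .
qed

text \<open>Sizes closer than \<open>\<beta> * \<mu> m\<close> to the mean give accurate estimates,
  and the last hypothesis keeps them within the pivot, so that the loop stops on them.\<close>

lemma success_ge_of_small_deviation: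
  assumes "y \<le> \<beta>\<^sup>2 * \<mu> m" "0 < y" "(1 + \<beta>) * \<mu> m \<le> P"
  shows "1 - 1 / y \<le> success (l + m)"
proof -
  let ?dev = "{X. \<beta> * \<mu> m \<le> \<bar>real X - \<mu> m\<bar>}"
  have "X \<in> accepting m" if "X \<in> - ?dev" for X
  proof (rule acceptingI)
    from that have X: "real X < (1 + \<beta>) * \<mu> m" "(1 - \<beta>) * \<mu> m < real X"
      by (auto simp: algebra_simps abs_if split: if_splits)
    show "(1 - \<beta>) * \<mu> m < real X" by fact
    have "(1 + \<beta>) * \<mu> m \<le> (1 + \<epsilon>) * \<mu> m"
      using \<beta>(3) \<mu>_pos[of m] by simp
    then show "real X \<le> (1 + \<epsilon>) * \<mu> m"
      using X by linarith
    show "X \<le> P"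
      using X assms(3) by linarith
  qed
  then have "measure_pmf.prob (D m) (- ?dev) \<le> measure_pmf.prob (D m) (accepting m)"
    by (intro measure_pmf.finite_measure_mono) auto
  moreover have "measure_pmf.prob (D m) (- ?dev) = 1 - measure_pmf.prob (D m) ?dev"
    using measure_pmf.prob_compl[of ?dev "D m"] by (simp add: Compl_eq_Diff_UNIV)
  ultimately show ?thesis
    using prob_deviation[OF assms(1,2)] success_ge_accepting[of m] by linarith
qed

lemma prob_small_cell:
  assumes "2 * real P \<le> \<mu> m"
  shows "measure_pmf.prob (D m) {X. X \<le> P} \<le> 0.1 * P / \<mu> m"
proof -
  have "measure_pmf.prob (D m) {X. X \<le> P}
      \<le> measure_pmf.prob (D m) {X. \<mu> m / 2 \<le> \<bar>real X - \<mu> m\<bar>}"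
    using assms by (intro measure_pmf.finite_measure_mono) auto
  also have "\<dots> \<le> \<mu> m / (\<mu> m / 2)\<^sup>2"
    using cell_size_chebyshev[OF R_subset, of "\<mu> m / 2" m] \<mu>_pos[of m] by (simp add: \<mu>_def[symmetric])
  also have "\<dots> = 4 / \<mu> m"
    using \<mu>_pos[of m] by (simp add: power2_eq_square)
  \<comment> \<open>Here \<open>4 \<le> 0.1 * P\<close> because \<open>40 \<le> P\<close>.\<close>
  also have "\<dots> \<le> 0.1 * P / \<mu> m"
    using \<mu>_pos[of m] P_ge by (intro divide_right_mono) auto
  finally show ?thesis .
qed

lemma prob_not_stopping:
  fixes x :: real
  assumes "\<mu> m = x * P" "x < 1" "0 < x"
  shows "measure_pmf.prob (D m) {X. P < X} \<le> x / (x + 40 * (1 - x)\<^sup>2)"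
proof -
  have P: "0 < real P" "40 \<le> real P"
    using P_ge by auto
  have "measure_pmf.prob (D m) {X. P < X}
      \<le> measure_pmf.prob (D m) {X. \<mu> m + (1 - x) * P \<le> real X}"
    unfolding assms(1) by (intro measure_pmf.finite_measure_mono) (auto simp: algebra_simps)
  also have "\<dots> \<le> \<mu> m / (\<mu> m + ((1 - x) * P)\<^sup>2)"
    using cell_size_cantelli_upper[OF R_subset, of "(1 - x) * P" m] P assms(2) by (simp add: \<mu>_def[symmetric])
  also have "\<mu> m + ((1 - x) * P)\<^sup>2 = P * (x + P * (1 - x)\<^sup>2)"
    unfolding assms(1) by (simp add: power2_eq_square algebra_simps)
  also have "\<mu> m / (P * (x + P * (1 - x)\<^sup>2)) = x / (x + P * (1 - x)\<^sup>2)"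
    unfolding assms(1) using P by simp
  also have "\<dots> \<le> x / (x + 40 * (1 - x)\<^sup>2)"
    using assms P by (intro divide_left_mono add_left_mono mult_right_mono mult_pos_pos add_pos_nonneg) auto
  finally show ?thesis .
qed

text \<open>Only the last iteration before \<open>m\<close> needs the sharp Cantelli bound; in the earlier ones
  any cell of size at most \<open>P\<close> counts as a failure, and these failure probabilities sum geometrically.\<close>

lemma success_backwards:
  fixes x :: real
  assumes \<mu>: "\<mu> m = x * P" and x: "1 / 2 \<le> x" and "l + m \<le> n"
    and v: "v \<le> success (l + m)" "0 \<le> v" "v \<le> 1"
    and "j < m"
  shows "v * (1 - (1 / (1 + 19.6 * x) + 0.1 / x * (1 / 2 - 1 / 2 ^ Suc j))) \<le> success (l + (m - Suc j))"
  using \<open>j < m\<close>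
proof (induction j)
  case 0
  define k where "k = m - 1"
  have k: "Suc k = m" "l + k < n"
    using 0 assms(3) by (auto simp: k_def)
  have \<mu>k: "\<mu> k = 2 * x * P"
    using \<mu>_Suc[of k] \<mu> k by simp
  \<comment> \<open>The mean is at least \<open>P\<close>, so a cell within the pivot cannot
    overestimate and only the lower tail is bad.\<close>
  have P_le: "real P \<le> \<mu> k"
    unfolding \<mu>k using x mult_right_mono[of 1 "2 * x" "real P"] by simp
  have "v * (1 - measure_pmf.prob (D k) {X. real X \<le> (1 - \<beta>) * \<mu> k}) \<le> success (l + k)"
  proof (rule success_step_avoiding)
    fix X assume "X \<notin> {X. real X \<le> (1 - \<beta>) * \<mu> k}" "X \<le> P"
    moreover have "\<mu> k \<le> (1 + \<epsilon>) * \<mu> k"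
      using \<epsilon> \<mu>_pos[of k] by simp
    ultimately show "X \<in> accepting k"
      using P_le by (intro acceptingI) auto
  qed (use k v in auto)
  moreover have "measure_pmf.prob (D k) {X. real X \<le> (1 - \<beta>) * \<mu> k} \<le> 1 / (1 + 19.6 * x)"
    using mult_left_mono[OF \<beta>(5), of "2 * x"] x
    by (intro prob_lower_tail) (auto simp: \<mu>k algebra_simps)
  ultimately have "v * (1 - 1 / (1 + 19.6 * x)) \<le> success (l + k)"
    using v(2) by (meson diff_left_mono mult_left_mono order_trans)
  then show ?case
    by (simp add: k_def)
next
  case (Suc j)
  define k where "k = m - Suc (Suc j)"
  define E where "E = 1 / (1 + 19.6 * x) + 0.1 / x * (1 / 2 - 1 / 2 ^ Suc j)"
  \<comment> \<open>The failure bounds form a geometric series; the previous steps contributed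
    \<open>0.1 / x * (1 / 2 - 1 / 2 ^ Suc j)\<close>, and this is the next term.\<close>
  define f where "f = 0.1 / (2 ^ Suc (Suc j) * x)"
  have k: "k + Suc (Suc j) = m" "l + k < n"
    using Suc.prems assms(3) by (auto simp: k_def)
  have Sk: "Suc k = m - Suc j"
    using k by auto
  have \<mu>k: "\<mu> k = 2 ^ Suc (Suc j) * x * P"
    using \<mu> unfolding k(1)[symmetric] by (simp add: \<mu>_def power_add field_simps)
  have pw: "(1 :: real) \<le> 2 ^ j"
    by simp
  have "1 \<le> 2 ^ j * (2 * x)"
    using mult_mono[OF pw, of 1 "2 * x"] x by simp
  then have big: "2 \<le> 2 ^ Suc (Suc j) * x"
    by (simp add: mult_ac)
  have "0 \<le> (1 :: real) / 2 - 1 / 2 ^ Suc j"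
    using pw by (simp add: field_simps)
  then have E0: "0 \<le> E"
    unfolding E_def using x by (intro add_nonneg_nonneg mult_nonneg_nonneg) auto
  have f: "0 \<le> f"
    using x by (simp add: f_def)
  have "0 < P"
    using P_ge by simp
  have bad: "measure_pmf.prob (D k) {X. X \<le> P} \<le> f"
  proof -
    have "measure_pmf.prob (D k) {X. X \<le> P} \<le> 0.1 * P / \<mu> k"
      using mult_right_mono[OF big, of "real P"] by (intro prob_small_cell) (simp add: \<mu>k)
    also have "\<dots> = f"
      using \<open>0 < P\<close> by (simp add: \<mu>k f_def)
    finally show ?thesis .
  qed
  have E_eq: "1 / (1 + 19.6 * x) + 0.1 / x * (1 / 2 - 1 / 2 ^ Suc (Suc j)) = E + f"
  proof -
    have "0.1 / x * (1 / 2 - 1 / 2 ^ Suc (Suc j)) = 0.1 / x * (1 / 2 - 1 / 2 ^ Suc j) + f"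
      using x by (simp add: f_def divide_simps)
    then show ?thesis
      by (simp add: E_def)
  qed
  show ?case
  \<comment> \<open>\<open>success_step_avoiding\<close> needs a nonnegative value; for
    \<open>E > 1\<close> the claimed bound is at most \<open>0\<close>.\<close>
  proof (cases "E \<le> 1")
    case True
    have IH: "v * (1 - E) \<le> success (l + Suc k)"
      using Suc.IH Suc.prems unfolding E_def Sk by simp
    have vE: "0 \<le> v * (1 - E)" "v * (1 - E) \<le> 1"
      using v E0 True by (auto intro: mult_le_one)
    have "v * (1 - (E + f)) \<le> v * (1 - E) * (1 - f)"
    proof -
      have "v * (1 - E) * (1 - f) = v * (1 - (E + f)) + v * (E * f)"
        by (simp add: algebra_simps)
      then show ?thesis
        using v E0 f by simp
    qed
    also have "\<dots> \<le> v * (1 - E) * (1 - measure_pmf.prob (D k) {X. X \<le> P})"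
      using bad vE by (intro mult_left_mono) auto
    also have "\<dots> \<le> success (l + k)"
      by (rule success_step_avoiding[OF k(2) IH vE]) auto
    finally show ?thesis
      unfolding E_eq k_def .
  next
    case False
    then have "v * (1 - (E + f)) \<le> 0"
      using v f by (simp add: mult_nonneg_nonpos)
    moreover have "0 \<le> success (l + k)"
      by (simp add: success_def)
    ultimately show ?thesis
      unfolding E_eq k_def by linarith
  qed
qed

text \<open>Replacing the partial geometric sum by its limit makes the loss independent of
  \<open>m\<close>.\<close>

lemma success_initial:
  fixes x :: real
  assumes \<mu>: "\<mu> m = x * P" and x: "1 / 2 \<le> x" and "l + m \<le> n" "0 < m"
    and v: "v \<le> success (l + m)" "0 \<le> v" "v \<le> 1"
  shows "v * (1 - (1 / (1 + 19.6 * x) + 0.05 / x)) \<le> success l"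
proof -
  have "0.1 / x * (1 / 2 - 1 / 2 ^ m) \<le> 0.1 / x * (1 / 2)"
    using x by (intro mult_left_mono) auto
  then have "1 - (1 / (1 + 19.6 * x) + 0.05 / x)
      \<le> 1 - (1 / (1 + 19.6 * x) + 0.1 / x * (1 / 2 - 1 / 2 ^ m))"
    by simp
  then have "v * (1 - (1 / (1 + 19.6 * x) + 0.05 / x))
      \<le> v * (1 - (1 / (1 + 19.6 * x) + 0.1 / x * (1 / 2 - 1 / 2 ^ m)))"
    using v(2) by (rule mult_left_mono)
  also have "\<dots> \<le> success l"
    using success_backwards[OF \<mu> x assms(3) v, of "m - 1"] \<open>0 < m\<close> by simp
  finally show ?thesis .
qed

section \<open>The critical iteration and the iteration limit\<close>

text \<open>Take the least \<open>m\<close> whose mean is below \<open>P\<close>. It is positive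
  since \<open>\<mu> 0 = card R\<close> exceeds \<open>P\<close>, and as means halve, minimality
  gives the lower bound.\<close>

lemma critical_iteration:
  obtains m where "0 < m" "real P / 2 \<le> \<mu> m" "\<mu> m < P"
proof -
  have "\<exists>m. \<mu> m < P"
  proof -
    obtain m where "real (card R) < 2 ^ m"
      using real_arch_pow[of 2 "real (card R)"] by auto
    then have "\<mu> m < 1"
      by (simp add: \<mu>_def)
    then show ?thesis
      using P_ge by (intro exI[of _ m]) simp
  qed
  then obtain m where m: "\<mu> m < P" "\<And>k. k < m \<Longrightarrow> \<not> \<mu> k < P"
    using exists_least_iff[of "\<lambda>m. \<mu> m < P"] by blast
  have "\<mu> 0 > P"
    using P_less by (simp add: \<mu>_def)
  then have "m \<noteq> 0"
    using m(1) by (metis less_asym)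
  then obtain k where "m = Suc k"
    using not0_implies_Suc by blast
  with m \<mu>_Suc[of k] have "real P / 2 \<le> \<mu> m"
    by fastforce
  with \<open>m \<noteq> 0\<close> m(1) show thesis
    by (intro that[of m]) auto
qed

lemma card_R_le: "real (card R) \<le> 2 ^ n"
proof -
  have "card R \<le> card (cube n)"
    using R_subset by (intro card_mono) auto
  then show ?thesis
    by (simp add: card_cube)
qed

text \<open>Combining \<open>card R \<le> 2 ^ n\<close> with \<open>2 ^ Suc l \<le> P\<close> gives
  \<open>2 ^ (l + m) * (2 * x) \<le> 2 ^ n\<close>. The strict version ensures that the loop may
  still run one iteration after the critical one.\<close>

lemma iterations_le:
  fixes x :: real
  assumes "\<mu> m = x * P"
  shows "1 / 2 \<le> x \<Longrightarrow> l + m \<le> n" "1 / 2 < x \<Longrightarrow> l + m < n"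
proof -
  have lP: "2 * 2 ^ l \<le> real P"
    using l by (metis of_nat_le_iff of_nat_numeral of_nat_power power_Suc)
  have up: "2 ^ m * (x * P) \<le> 2 ^ n"
    using card_R_le unfolding assms[symmetric] \<mu>_def by simp
  have low: "2 ^ (l + m) * (2 * x) \<le> 2 ^ m * (x * P)" if "1 / 2 \<le> x"
  proof -
    have "2 ^ m * x * (2 * 2 ^ l) \<le> 2 ^ m * x * P"
      using lP that by (intro mult_left_mono) auto
    then show ?thesis
      by (simp add: power_add mult.commute mult.left_commute)
  qed
  show "l + m \<le> n" if "1 / 2 \<le> x"
  proof -
    have "(2 :: real) ^ (l + m) * 1 \<le> 2 ^ (l + m) * (2 * x)"
      using that by (intro mult_left_mono) auto
    then have "(2 :: real) ^ (l + m) \<le> 2 ^ n"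
      using low[OF that] up by linarith
    then show ?thesis
      by (simp add: power_le_imp_le_exp)
  qed
  show "l + m < n" if "1 / 2 < x"
  proof -
    have "(2 :: real) ^ (l + m) * 1 < 2 ^ (l + m) * (2 * x)"
      using that by (intro mult_strict_left_mono) auto
    then have "(2 :: real) ^ (l + m) < 2 ^ n"
      using low[OF less_imp_le[OF that]] up by linarith
    then show ?thesis
      by (simp add: power_less_imp_less_exp)
  qed
qed

section \<open>Optimisation over the position of the critical mean\<close>

lemma success_ge: "0.61 \<le> success l"
proof -
  obtain m where m: "0 < m" "real P / 2 \<le> \<mu> m" "\<mu> m < P"
    by (rule critical_iteration)
  define x where "x = \<mu> m / P"
  have P: "0 < real P"
    using P_ge by simp
  have \<mu>: "\<mu> m = x * P"
    using P by (simp add: x_def)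
  have x: "1 / 2 \<le> x" "x < 1"
    using m P by (simp_all add: x_def field_simps)
  define E where "E = 1 / (1 + 19.6 * x) + 0.05 / x"
  have \<beta>\<mu>: "9.8 * x \<le> \<beta>\<^sup>2 * \<mu> m"
    using mult_left_mono[OF \<beta>(5), of x] x by (simp add: \<mu> algebra_simps)
  show ?thesis
  proof (cases "(1 + \<beta>) * x \<le> 1")
    \<comment> \<open>The whole accurate window lies within the pivot, so iteration \<open>m\<close>
      alone is good enough.\<close>
    case True
    have "(1 + \<beta>) * \<mu> m \<le> P"
      using mult_right_mono[OF True, of P] by (simp add: \<mu> algebra_simps)
    moreover have "4.9 \<le> \<beta>\<^sup>2 * \<mu> m"
      using \<beta>\<mu> x by simp
    ultimately have "1 - 1 / 4.9 \<le> success (l + m)"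
      by (intro success_ge_of_small_deviation) auto
    then have "0.79 * (1 - E) \<le> success l"
      unfolding E_def using x m iterations_le(1)[OF \<mu>] by (intro success_initial[OF \<mu>]) auto
    moreover have "E \<le> 1 / 10.8 + 0.1"
      unfolding E_def using x by (intro add_mono) (auto simp: divide_simps)
    ultimately show ?thesis
      by simp
  next
    case False
    have "x * (1 + \<beta>) \<le> x * (3 / 2)"
      using \<beta>(2) x by (intro mult_left_mono) auto
    then have x23: "2 / 3 < x"
      using False by (simp add: algebra_simps)
    define A C where "A = measure_pmf.prob (D m) {X. real X \<le> (1 - \<beta>) * \<mu> m}"
      and "C = measure_pmf.prob (D m) {X. P < X}"
    define v where "v = 1 - 1 / (4.9 * x)"
    define w where "w = x + 40 * (1 - x)\<^sup>2"
    have w: "0 < w"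
      using x by (auto simp: w_def add_pos_nonneg)
    have v: "v \<le> success (l + Suc m)"
      unfolding v_def
    proof (rule success_ge_of_small_deviation)
      have "(1 + \<beta>) * x \<le> 2 * 1"
        using \<beta> x by (intro mult_mono) auto
      then have "(1 + \<beta>) * x * P \<le> 2 * 1 * real P"
        by (rule mult_right_mono) simp
      then show "(1 + \<beta>) * \<mu> (Suc m) \<le> P"
        unfolding \<mu>_Suc \<mu> by simp
    qed (use \<beta>\<mu> x in \<open>auto simp: \<mu>_Suc\<close>)
    have "1 - A - C \<le> measure_pmf.prob (D m) (accepting m)"
    proof -
      \<comment> \<open>Since \<open>(1 + \<beta>) * x > 1\<close>, the upper accuracy limit lies
        above \<open>P\<close> and holds for every cell within the pivot.\<close>
      have "X \<in> accepting m" if "\<not> real X \<le> (1 - \<beta>) * \<mu> m" "\<not> P < X" for X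
      proof (rule acceptingI)
        have "1 * real P \<le> (1 + \<beta>) * x * P"
          using False by (intro mult_right_mono) auto
        also have "\<dots> \<le> (1 + \<epsilon>) * x * P"
          using \<beta> x by (intro mult_right_mono) auto
        finally show "real X \<le> (1 + \<epsilon>) * \<mu> m"
          using that by (simp add: \<mu> mult.assoc)
      qed (use that in auto)
      then have "UNIV \<subseteq> accepting m \<union> {X. P < X} \<union> {X. real X \<le> (1 - \<beta>) * \<mu> m}"
        by auto
      then have "measure_pmf.prob (D m) UNIV
          \<le> measure_pmf.prob (D m) (accepting m \<union> {X. P < X} \<union> {X. real X \<le> (1 - \<beta>) * \<mu> m})"
        by (intro measure_pmf.finite_measure_mono) auto
      also have "\<dots> \<le> measure_pmf.prob (D m) (accepting m) + C + A"
        unfolding A_def C_def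
        by (intro order_trans[OF measure_Un_le] add_right_mono measure_Un_le) auto
      finally show ?thesis
        by simp
    qed
    \<comment> \<open>Overshooting \<open>P\<close> costs only the failure probability of the next
      iteration.\<close>
    then have "1 - A - C * (1 - v) \<le> success (l + m)"
      using success_step[OF iterations_le(2)[OF \<mu>] v] x23 by (simp add: C_def algebra_simps)
    moreover have "A \<le> 1 / (1 + 9.8 * x)"
      unfolding A_def using \<beta>\<mu> x by (intro prob_lower_tail) auto
    moreover have "C * (1 - v) \<le> 1 / (4.9 * w)"
    proof -
      have "C * (1 - v) \<le> x / w * (1 - v)"
        unfolding C_def w_def using x
        by (intro mult_right_mono prob_not_stopping \<mu>) (auto simp: v_def)
      also have "\<dots> = 1 / (4.9 * w)"
        using x by (simp add: v_def)
      finally show ?thesis .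
    qed
    ultimately have sm: "1 - 1 / (1 + 9.8 * x) - 1 / (4.9 * w) \<le> success (l + m)"
      by linarith
    have step: "u * (1 - E) \<le> success l" if "u \<le> success (l + m)" "0 \<le> u" "u \<le> 1" for u
      unfolding E_def using x m iterations_le(1)[OF \<mu>] that by (intro success_initial[OF \<mu>]) auto
    show ?thesis
    \<comment> \<open>The lower-tail bound and \<open>E\<close> are worst for small
      \<open>x\<close>, whereas \<open>w\<close> is smallest near \<open>1\<close>. Combining the
      worst values over the whole range would fall short of \<open>0.61\<close>, hence the
      split.\<close>
    proof (cases "x \<ge> 0.87")
      case True
      \<comment> \<open>Completing the square at the minimum \<open>79 / 80\<close> of
        \<open>w\<close>.\<close>
      have "w = 159 / 160 + 40 * (x - 79 / 80)\<^sup>2"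
        by (simp add: w_def power2_eq_square algebra_simps)
      then have "159 / 160 \<le> w"
        by simp
      then have "1 / (4.9 * w) \<le> 1 / (4.9 * (159 / 160))"
        using w by (intro divide_left_mono) auto
      moreover have "1 / (1 + 9.8 * x) \<le> 1 / (1 + 9.8 * 0.87)"
        using True by (intro divide_left_mono) auto
      ultimately have "0.6895 \<le> success (l + m)"
        using sm by simp
      from step[OF this] have "0.6895 * (1 - E) \<le> success l"
        by simp
      moreover have "E \<le> 1 / (1 + 19.6 * 0.87) + 0.05 / 0.87"
        unfolding E_def using True by (intro add_mono divide_left_mono) auto
      ultimately show ?thesis
        by simp
    next
      case False
      \<comment> \<open>The value of \<open>w\<close> at \<open>0.87\<close> is
        \<open>1.546\<close>; the factorisation shows that \<open>w\<close> is no smaller to the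
        left.\<close>
      have "w - 1.546 = (0.87 - x) * (44.2 - 40 * x)"
        by (simp add: w_def power2_eq_square algebra_simps)
      moreover have "0 \<le> (0.87 - x) * (44.2 - 40 * x)"
        using False x by (intro mult_nonneg_nonneg) auto
      ultimately have "1.546 \<le> w"
        by linarith
      then have "1 / (4.9 * w) \<le> 1 / (4.9 * 1.546)"
        using w by (intro divide_left_mono) auto
      moreover have "1 / (1 + 9.8 * x) \<le> 1 / (1 + 9.8 * (2 / 3))"
        using x23 by (intro divide_left_mono) auto
      ultimately have "0.735 \<le> success (l + m)"
        using sm by simp
      from step[OF this] have "0.735 * (1 - E) \<le> success l"
        by simp
      moreover have "E \<le> 1 / (1 + 19.6 * (2 / 3)) + 0.05 / (2 / 3)"
        unfolding E_def using x23 by (intro add_mono divide_left_mono) auto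
      ultimately show ?thesis
        by simp
    qed
  qed
qed

end

section \<open>Numerical constants and the final assembly\<close>

text \<open>The estimate \<open>1 + x \<le> exp x\<close> at \<open>x = 1 / 128\<close>, raised to
  the power \<open>64\<close>, is just sharp enough for \<open>1.645\<close>.\<close>

lemma exp_half_ge: "1.645 \<le> exp (1 / 2 :: real)"
proof -
  have "(1 + 1 / 128 :: real) ^ 64 \<le> exp (1 / 128) ^ 64"
    by (intro power_mono exp_ge_add_one_self) auto
  also have "\<dots> = exp (1 / 2)"
    by (simp flip: exp_of_nat_mult)
  finally show ?thesis
    by (simp add: power_divide)
qed

text \<open>The upper bound yields the constant \<open>0.6\<close>; the lower bound keeps the
  claimed probability below the \<open>0.61\<close> of \<open>success_ge\<close>.\<close>

lemma exp_neg_three_halves_bounds: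
  "0.22 \<le> exp (- (3 / 2) :: real)" "exp (- (3 / 2) :: real) \<le> 0.225"
proof -
  have "exp (3 / 2 :: real) ^ 2 = exp 1 ^ 3"
    by (simp flip: exp_of_nat_mult)
  also have "\<dots> \<le> 2.72 ^ 3"
    using e_less_272 by (intro power_mono) auto
  also have "\<dots> \<le> (4.5 :: real) ^ 2"
    by (simp add: power2_eq_square power3_eq_cube)
  finally have "exp (3 / 2 :: real) \<le> 4.5"
    by (rule power2_le_imp_le) simp
  then show "0.22 \<le> exp (- (3 / 2) :: real)"
    by (simp add: exp_minus field_simps)
  have "(1.645 :: real) ^ 3 \<le> exp (1 / 2) ^ 3"
    using exp_half_ge by (intro power_mono) auto
  also have "\<dots> = exp (3 / 2)"
    by (simp flip: exp_of_nat_mult)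
  finally show "exp (- (3 / 2) :: real) \<le> 0.225"
    by (simp add: exp_minus field_simps)
qed

theorem theorem2:
  fixes n pivot :: nat and F :: cnf and \<epsilon> :: real
    and B :: "cnf_xor \<Rightarrow> nat \<Rightarrow> (nat \<Rightarrow> bit) set"
  assumes "cnf_over n F"
    and "0 < \<epsilon>" and "\<epsilon> \<le> 1"
    and "pivot = nat (2 * \<lceil>3 * exp (1/2) * (1 + 1/\<epsilon>)^2\<rceil>)"
    and "is_BoundedSAT n B"
  shows "measure_pmf.prob (ApproxMCCore B n F pivot)
           {r. \<exists>c. r = Some c \<and>
                inverse (1 + \<epsilon>) * real (card (sat_assignments n F)) \<le> real c \<and>
                real c \<le> (1 + \<epsilon>) * real (card (sat_assignments n F))}
         \<ge> (1 - exp (- (3/2)))^2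
       \<and> (1 - exp (- (3/2)) :: real)^2 > 0.6"
    (is "?q \<le> measure_pmf.prob _ ?G \<and> _")
proof
  have "0.775 ^ 2 \<le> ?q"
    using exp_neg_three_halves_bounds by (intro power_mono) auto
  then show "?q > 0.6"
    by (simp add: power2_eq_square)
  have q: "?q \<le> 61 / 100"
  proof -
    have "?q \<le> 0.78 ^ 2"
      using exp_neg_three_halves_bounds by (intro power_mono) auto
    then show ?thesis
      by (simp add: power2_eq_square)
  qed
  define z where "z = \<lceil>3 * exp (1/2) * (1 + 1/\<epsilon>)^2\<rceil>"
  have z: "4.9 * (1 + 1/\<epsilon>)^2 \<le> z"
  proof -
    have "4.9 * (1 + 1/\<epsilon>)^2 \<le> 3 * exp (1/2) * (1 + 1/\<epsilon>)^2"
      using exp_half_ge by (intro mult_right_mono) auto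
    also have "\<dots> \<le> z"
      unfolding z_def by (rule le_of_int_ceiling)
    finally show ?thesis .
  qed
  \<comment> \<open>This gives \<open>z \<ge> 19.6\<close>, and integrality lifts it to
    \<open>20\<close>.\<close>
  have "2 ^ 2 \<le> (1 + 1/\<epsilon>)^2"
    using assms(2,3) by (intro power_mono) auto
  then have "real_of_int 19 < z"
    using z by simp
  then have "20 \<le> z"
    by linarith
  then have pivot: "real pivot = 2 * of_int z" "40 \<le> pivot"
    using assms(4) unfolding z_def[symmetric] by auto
  define l where "l = nat (\<lfloor>log 2 (real pivot)\<rfloor> - 1)"
  \<comment> \<open>This keeps \<open>nat\<close> from truncating, so that \<open>Suc l\<close> is
    the floor of the logarithm.\<close>
  have "1 \<le> \<lfloor>log 2 (real pivot)\<rfloor>"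
    using pivot by (simp add: le_floor_iff le_log_iff)
  then have "real (Suc l) \<le> log 2 (real pivot)"
    by (auto simp: l_def)
  then have l: "2 ^ Suc l \<le> pivot"
  proof -
    have "2 powr real (Suc l) \<le> real pivot"
      using \<open>real (Suc l) \<le> log 2 (real pivot)\<close> pivot(2) by (simp add: le_log_iff)
    then have "real (2 ^ Suc l) \<le> real pivot"
      by (simp only: powr_realpow zero_less_numeral of_nat_power of_nat_numeral)
    then show ?thesis
      by (simp only: of_nat_le_iff)
  qed
  have card_B: "card (B (F, []) (Suc pivot)) = min (Suc pivot) (card (sat_assignments n F))"
    using assms(5)[unfolded is_BoundedSAT_def, rule_format, of "(F, [])" "Suc pivot"] assms(1)
    by (simp add: models_Nil)
  show "?q \<le> measure_pmf.prob (ApproxMCCore B n F pivot) ?G"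
  proof (cases "card (sat_assignments n F) \<le> pivot")
    case True
    let ?N = "card (sat_assignments n F)"
    have "inverse (1 + \<epsilon>) * real ?N \<le> 1 * real ?N" "1 * real ?N \<le> (1 + \<epsilon>) * real ?N"
      using assms(2) by (auto intro!: mult_right_mono simp: field_simps)
    then have "Some ?N \<in> ?G"
      by simp
    moreover have "ApproxMCCore B n F pivot = return_pmf (Some ?N)"
      using True by (simp add: ApproxMCCore_def Let_def card_B)
    ultimately have "measure_pmf.prob (ApproxMCCore B n F pivot) ?G = 1"
      by (simp only: measure_return_pmf indicator_simps)
    moreover have "?q \<le> 1"
      using q by linarith
    ultimately show ?thesis
      by simp
  next
    case False
    interpret approx_mc_core_run B n pivot l F \<epsilon>
      using assms z pivot l False by unfold_locales auto
    have "ApproxMCCore B n F pivot = ApproxMCCore_loop B n F pivot l l"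
      using False by (simp add: ApproxMCCore_def Let_def card_B l_def)
    then show ?thesis
      using success_ge q by (simp add: success_def G_def)
  qed
qed

end
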